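(* Let $\mathcal{H}$ be a complex Hilbert space and let $A,B\in L(\mathcal{H})$. The following conditions are equivalent: (1) $R(B)=R(A)\dotplus R(B-A)$ (that is, $A$ is below $B$ in the left minus order); (2) there exists an inner inverse $A^-$ of $A$ such that $A^-A=A^-B$ and $AA^-x=BA^-x$ for every $x\in\mathcal{D}(A^-)$.
   Context: $L(\mathcal{H})$ is the algebra of bounded linear operators on $\mathcal{H}$, $R(T)$ is the range of $T$, and $\dotplus$ denotes a direct (algebraic) sum of linear subspaces (trivial intersection). An inner inverse of $A\in L(\mathcal{H})$ is a (not necessarily bounded) linear operator $A^-:\mathcal{D}(A^-)\to\mathcal{H}$ defined on a dense linear subspace $\mathcal{D}(A^-)\subseteq\mathcal{H}$ with $R(A)\subseteq\mathcal{D}(A^-)$ and $AA^-A=A$. The equality $A^-A=A^-B$ includes the requirement $R(B)\subseteq\mathcal{D}(A^-)$. *)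

theory Defs
  imports "HOL-Analysis.Analysis"
begin

text \<open>
  The distribution has no complex inner product spaces. The classes below extend the real normed
  structure by a compatible complex scaling and a sesquilinear form (linear in the first argument)
  that induces the norm; positive definiteness is inherited from the norm via
  \<open>cinner_eq_norm_square\<close>.
\<close>

class complex_inner = real_normed_vector +
  fixes scaleC :: "complex \<Rightarrow> 'a \<Rightarrow> 'a" (infixr \<open>*\<^sub>C\<close> 75)
    and cinner :: "'a \<Rightarrow> 'a \<Rightarrow> complex"
  assumes scaleC_add_right: "c *\<^sub>C (x + y) = c *\<^sub>C x + c *\<^sub>C y"
    and scaleC_add_left: "(c + d) *\<^sub>C x = c *\<^sub>C x + d *\<^sub>C x"
    and scaleC_scaleC: "c *\<^sub>C (d *\<^sub>C x) = (c * d) *\<^sub>C x"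
    and scaleR_scaleC: "r *\<^sub>R x = complex_of_real r *\<^sub>C x"
    and cinner_commute: "cinner x y = cnj (cinner y x)"
    and cinner_add_left: "cinner (x + y) z = cinner x z + cinner y z"
    and cinner_scaleC_left: "cinner (c *\<^sub>C x) y = c * cinner x y"
    and cinner_eq_norm_square: "cinner x x = complex_of_real ((norm x)\<^sup>2)"

class chilbert_space = complex_inner + complete_space

lemma scaleC_one: "1 *\<^sub>C x = (x :: 'a :: complex_inner)"
  by (metis of_real_1 scaleR_one scaleR_scaleC)

global_interpretation complex_vector:
  vector_space "scaleC :: complex \<Rightarrow> 'a \<Rightarrow> 'a :: complex_inner"
  by unfold_locales
    (simp_all add: scaleC_add_right scaleC_add_left scaleC_scaleC scaleC_one)

instantiation complex :: chilbert_space
begin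

definition scaleC_complex :: "complex \<Rightarrow> complex \<Rightarrow> complex"
  where "scaleC_complex c x = c * x"

definition cinner_complex :: "complex \<Rightarrow> complex \<Rightarrow> complex"
  where "cinner_complex x y = x * cnj y"

instance
  by standard
    (simp_all add: scaleC_complex_def cinner_complex_def scaleR_conv_of_real algebra_simps
      complex_norm_square del: of_real_power)

end

definition bounded_clinear :: "('a :: complex_inner \<Rightarrow> 'b :: complex_inner) \<Rightarrow> bool"
  where "bounded_clinear T \<longleftrightarrow>
    Vector_Spaces.linear scaleC scaleC T \<and> (\<exists>K. \<forall>x. norm (T x) \<le> K * norm x)"

definition is_direct_sum :: "'a :: ab_group_add set \<Rightarrow> 'a set \<Rightarrow> 'a set \<Rightarrow> bool"
  where "is_direct_sum S M N \<longleftrightarrow> S = {x + y | x y. x \<in> M \<and> y \<in> N} \<and> M \<inter> N = {0}"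

text \<open>
  An operator with domain \<open>D\<close> is represented by \<open>D\<close> together with a total function, whose values
  outside \<open>D\<close> carry no meaning.
\<close>

definition clinear_on :: "'a :: complex_inner set \<Rightarrow> ('a \<Rightarrow> 'b :: complex_inner) \<Rightarrow> bool"
  where "clinear_on D T \<longleftrightarrow> complex_vector.subspace D \<and>
    (\<forall>x\<in>D. \<forall>y\<in>D. T (x + y) = T x + T y) \<and> (\<forall>c. \<forall>x\<in>D. T (c *\<^sub>C x) = c *\<^sub>C T x)"

definition inner_inverse :: "('a :: complex_inner \<Rightarrow> 'a) \<Rightarrow> 'a set \<Rightarrow> ('a \<Rightarrow> 'a) \<Rightarrow> bool"
  where "inner_inverse A D X \<longleftrightarrow>
    clinear_on D X \<and> closure D = UNIV \<and> range A \<subseteq> D \<and> A \<circ> X \<circ> A = A"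

end

theory Submission
  imports Defs
begin

text \<open>
  If the sum is direct, then \<open>B x \<mapsto> A x\<close> is well defined on \<open>R(B)\<close>, and \<open>A\<close> maps the kernel of
  \<open>B - A\<close> onto \<open>R(A)\<close>. As inner inverses may be unbounded, linear right inverses obtained from Hamel
  bases suffice: with \<open>h\<close> a right inverse of \<open>B\<close> and \<open>g\<close> a right inverse of \<open>A\<close> restricted to
  \<open>ker (B - A)\<close>, the everywhere defined operator \<open>g \<circ> A \<circ> h\<close> is the required inner inverse.
\<close>

lemma inner_inverse_of_is_direct_sum:
  fixes A B :: "'a :: complex_inner \<Rightarrow> 'a"
  assumes A: "Vector_Spaces.linear scaleC scaleC A" and B: "Vector_Spaces.linear scaleC scaleC B"
    and sum: "is_direct_sum (range B) (range A) (range (\<lambda>x. B x - A x))"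
  obtains X where "inner_inverse A UNIV X" "\<And>x. X (A x) = X (B x)" "\<And>x. A (X x) = B (X x)"
proof -
  interpret A: Vector_Spaces.linear scaleC scaleC A by fact
  interpret B: Vector_Spaces.linear scaleC scaleC B by fact
  interpret pair: vector_space_pair "scaleC :: complex \<Rightarrow> 'a \<Rightarrow> 'a"
    "scaleC :: complex \<Rightarrow> 'a \<Rightarrow> 'a"
    by unfold_locales
  define K where "K = {x. A x = B x}"
  have K: "complex_vector.subspace K"
    by (auto simp: K_def complex_vector.subspace_def A.add B.add A.scale B.scale A.zero B.zero)
  have int: "A u = 0" if "A u = B v - A v" for u v
    using sum that unfolding is_direct_sum_def by blast
  have lift: "\<exists>x. B x = A u \<and> A x = A u" for u
  proof -
    have "A u + (B 0 - A 0) \<in> range B"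
      using sum unfolding is_direct_sum_def by blast
    then obtain x where x: "B x = A u"
      by (auto simp: A.zero B.zero)
    then have "A (u - x) = 0"
      by (intro int[of _ x]) (simp add: A.diff)
    with x show ?thesis
      by (auto simp: A.diff)
  qed
  have ker: "A x = 0" if "B x = 0" for x
    using int[of "- x" x] that by (simp add: A.neg)
  obtain h where h: "Vector_Spaces.linear scaleC scaleC h" "\<And>x. B (h (B x)) = B x"
    using pair.linear_exists_right_inverse_on[OF B complex_vector.subspace_UNIV]
    by auto
  obtain g where g: "Vector_Spaces.linear scaleC scaleC g" "range g \<subseteq> K"
      "\<And>v. v \<in> A ` K \<Longrightarrow> A (g v) = v"
    using pair.linear_exists_right_inverse_on[OF A K] by auto
  interpret h: Vector_Spaces.linear scaleC scaleC h by fact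
  interpret g: Vector_Spaces.linear scaleC scaleC g by fact
  define X where "X = (\<lambda>x. g (A (h x)))"
  have XB: "X (B x) = g (A x)" for x
    using ker[of "h (B x) - x"] by (simp add: X_def A.diff B.diff h)
  have XA: "X (A u) = g (A u)" for u
    using lift[of u] XB by metis
  have AgA: "A (g (A u)) = A u" for u
  proof (rule g)
    show "A u \<in> A ` K"
      using lift[of u] by (auto simp: K_def image_iff) metis
  qed
  show ?thesis
  proof
    have "clinear_on UNIV X"
      by (simp add: clinear_on_def X_def A.add A.scale h.add h.scale g.add g.scale)
    then show "inner_inverse A UNIV X"
      by (simp add: inner_inverse_def fun_eq_iff XA AgA)
    show "X (A x) = X (B x)" for x
      by (simp add: XA XB)
    show "A (X x) = B (X x)" for x
      using g(2) by (auto simp: K_def X_def)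
  qed
qed

lemma is_direct_sum_of_inner_inverse:
  fixes A B :: "'a :: complex_inner \<Rightarrow> 'a"
  assumes A: "Vector_Spaces.linear scaleC scaleC A" and B: "Vector_Spaces.linear scaleC scaleC B"
    and X: "inner_inverse A D X"
    and XA: "\<And>x. X (A x) = X (B x)" and AX: "\<And>x. x \<in> D \<Longrightarrow> A (X x) = B (X x)"
  shows "is_direct_sum (range B) (range A) (range (\<lambda>x. B x - A x))"
proof -
  interpret A: Vector_Spaces.linear scaleC scaleC A by fact
  interpret B: Vector_Spaces.linear scaleC scaleC B by fact
  have lin: "clinear_on D X" and AD: "A x \<in> D" and AXA: "A (X (A x)) = A x" for x
    using X by (auto simp: inner_inverse_def fun_eq_iff)
  have BXA: "B (X (A x)) = A x" for x
    using AX[OF AD] AXA by simp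
  have "A u + (B v - A v) = B (X (A u) + v - X (A v))" for u v
    by (simp add: B.add B.diff BXA)
  moreover have "B x = A x + (B x - A x)" for x
    by simp
  ultimately have sum: "range B = {x + y | x y. x \<in> range A \<and> y \<in> range (\<lambda>x. B x - A x)}"
    by blast
  have "A u = 0" if uv: "A u = B v - A v" for u v
  proof -
    have "X (A u + A v) = X (A u) + X (A v)"
      using lin AD by (auto simp: clinear_on_def)
    then have "X (A u) = 0"
      using uv XA[of v] by simp
    then show ?thesis
      using AXA[of u] by (simp add: A.zero)
  qed
  moreover have "0 \<in> range A" "0 \<in> range (\<lambda>x. B x - A x)"
    by (auto simp: A.zero B.zero intro: range_eqI[of _ _ 0])
  ultimately have "range A \<inter> range (\<lambda>x. B x - A x) = {0}"
    by auto
  with sum show ?thesis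
    unfolding is_direct_sum_def by blast
qed

theorem proposition3p18:
  fixes A B :: "'a :: chilbert_space \<Rightarrow> 'a"
  assumes "bounded_clinear A" and "bounded_clinear B"
  shows "is_direct_sum (range B) (range A) (range (\<lambda>x. B x - A x)) \<longleftrightarrow>
    (\<exists>D X. inner_inverse A D X \<and>
      (range B \<subseteq> D \<and> (\<forall>x. X (A x) = X (B x))) \<and>
      (\<forall>x\<in>D. A (X x) = B (X x)))"
proof -
  have A: "Vector_Spaces.linear scaleC scaleC A" and B: "Vector_Spaces.linear scaleC scaleC B"
    using assms by (simp_all add: bounded_clinear_def)
  show ?thesis
  proof (intro iffI; (elim exE conjE)?)
    assume "is_direct_sum (range B) (range A) (range (\<lambda>x. B x - A x))"
    then obtain X where "inner_inverse A UNIV X" "\<And>x. X (A x) = X (B x)" "\<And>x. A (X x) = B (X x)"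
      using inner_inverse_of_is_direct_sum[OF A B] by blast
    then show "\<exists>D X. inner_inverse A D X \<and>
        (range B \<subseteq> D \<and> (\<forall>x. X (A x) = X (B x))) \<and> (\<forall>x\<in>D. A (X x) = B (X x))"
      by (intro exI[of _ UNIV] exI[of _ X]) simp
  qed (erule is_direct_sum_of_inner_inverse[OF A B]; simp)
qed

end
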